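(* Let $(P_k)_{k \ge 1}$ be the Pell number sequence $0, 1, 2, 5, 12, 29, 70, 169, 408, 985, 2378, \dots$, indexed so that $P_1 = 0$, $P_2 = 1$ and $P_{k+2} = 2P_{k+1} + P_k$ for all $k \ge 1$. Then for every integer $n \ge 0$, $$(P_{2n+3}+1)^5 + (P_{2n+3}-1)^5 = \bigl(P_{2n+3} + i (P_{2n+3}+P_{2n+2})\bigr)^5 + \bigl(P_{2n+3} - i (P_{2n+3}+P_{2n+2})\bigr)^5 .$$ This gives an infinite sequence of solutions of $w^5 + x^5 = y^5 + z^5$ with $w, x$ positive integers and $y, z$ Gaussian integers. The cases $n = 0,1,2,3,4$ are $$3^5 + 1^5 = (2 + 3i)^5 + (2 - 3i)^5,$$ $$13^5 + 11^5 = (12 + 17i)^5 + (12 - 17i)^5,$$ $$71^5 + 69^5 = (70 + 99i)^5 + (70 - 99i)^5,$$ $$409^5 + 407^5 = (408 + 577i)^5 + (408 - 577i)^5,$$ $$2379^5 + 2377^5 = (2378 + 3363i)^5 + (2378 - 3363i)^5 .$$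
   Context: Here $i$ denotes the imaginary unit, and a Gaussian integer is a complex number $p + iq$ with $p, q \in \mathbb{Z}$. Note the indexing of the Pell numbers: the first term is $P_1 = 0$, so that $P_3 = 2$, $P_4 = 5$, $P_5 = 12$, and so on. *)

theory Defs
  imports Complex_Main
begin

definition gaussian_integers :: "complex set" where
  "gaussian_integers = {of_int p + \<i> * of_int q | p q :: int. True}"

definition quintic_solutions :: "(int \<times> int \<times> complex \<times> complex) set" where
  "quintic_solutions =
     {(w, x, y, z). w > 0 \<and> x > 0 \<and> y \<in> gaussian_integers \<and> z \<in> gaussian_integers \<and>
        of_int w ^ 5 + of_int x ^ 5 = y ^ 5 + z ^ 5}"

text \<open>Sequences are indexed from 1; the value \<open>P 0\<close> is left unconstrained.\<close>

definition is_pell_sequence :: "(nat \<Rightarrow> int) \<Rightarrow> bool" where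
  "is_pell_sequence P \<longleftrightarrow>
     P 1 = 0 \<and> P 2 = 1 \<and> (\<forall>k\<ge>1. P (k + 2) = 2 * P (k + 1) + P k)"

definition pell_quadruple :: "(nat \<Rightarrow> int) \<Rightarrow> nat \<Rightarrow> int \<times> int \<times> complex \<times> complex" where
  "pell_quadruple P n =
     (P (2 * n + 3) + 1,
      P (2 * n + 3) - 1,
      of_int (P (2 * n + 3)) + \<i> * of_int (P (2 * n + 3) + P (2 * n + 2)),
      of_int (P (2 * n + 3)) - \<i> * of_int (P (2 * n + 3) + P (2 * n + 2)))"

end

theory Submission
  imports Defs
begin

text \<open>
  With \<open>a = P (2 * n + 3)\<close> and \<open>b = P (2 * n + 3) + P (2 * n + 2)\<close>, both sides are even in the term
  added to and subtracted from \<open>a\<close>: they equal \<open>2 a^5 + 20 a^3 + 10 a\<close> and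
  \<open>2 a^5 - 20 a^3 b^2 + 10 a b^4\<close>. These agree because \<open>b^2 - 2 a^2 = 1\<close>, the Pell equation, which
  the recurrence preserves.
\<close>

lemma quintic_identity:
  fixes a b j :: "'a :: comm_ring_1"
  assumes "j\<^sup>2 = - 1" and "b\<^sup>2 = 2 * a\<^sup>2 + 1"
  shows "(a + 1) ^ 5 + (a - 1) ^ 5 = (a + j * b) ^ 5 + (a - j * b) ^ 5"
proof -
  have even_part: "(a + t) ^ 5 + (a - t) ^ 5 = 2 * a ^ 5 + 20 * a ^ 3 * t\<^sup>2 + 10 * a * (t\<^sup>2)\<^sup>2" for t
    by (simp add: eval_nat_numeral algebra_simps)
  have jb: "(j * b)\<^sup>2 = - (2 * a\<^sup>2 + 1)"
    using assms by (simp add: power_mult_distrib)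
  show ?thesis
    \<comment> \<open>Substituting \<open>t\<^sup>2 = 1\<close> on the left and
      \<open>t\<^sup>2 = - (2 * a\<^sup>2 + 1)\<close> on the right eliminates \<open>j\<close> and
      \<open>b\<close>. On the right the extra terms of degree 5 cancel, leaving
      \<open>20 * a ^ 3 + 10 * a\<close> on both sides.\<close>
    unfolding even_part jb even_part[of 1]
    by (simp add: eval_nat_numeral algebra_simps)
qed

lemma pell_sequence_initial:
  assumes "is_pell_sequence P"
  shows "P 1 = 0" "P 2 = 1"
  using assms by (auto simp: is_pell_sequence_def)

lemma pell_sequence_rec:
  assumes "is_pell_sequence P" and "k \<ge> 1"
  shows "P (k + 2) = 2 * P (k + 1) + P k"
  using assms by (auto simp: is_pell_sequence_def)

lemma pell_sequence_values:
  assumes "is_pell_sequence P"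
  shows "P 3 = 2" "P 4 = 5" "P 5 = 12" "P 6 = 29" "P 7 = 70" "P 8 = 169" "P 9 = 408"
    "P 10 = 985" "P 11 = 2378"
proof -
  note rec = pell_sequence_rec[OF assms]
  show P3: "P 3 = 2" using rec[of 1] pell_sequence_initial[OF assms] by (simp add: numeral_eq_Suc)
  show P4: "P 4 = 5" using rec[of 2] P3 pell_sequence_initial[OF assms] by simp
  show P5: "P 5 = 12" using rec[of 3] P3 P4 by simp
  show P6: "P 6 = 29" using rec[of 4] P4 P5 by simp
  show P7: "P 7 = 70" using rec[of 5] P5 P6 by simp
  show P8: "P 8 = 169" using rec[of 6] P6 P7 by simp
  show P9: "P 9 = 408" using rec[of 7] P7 P8 by simp
  show P10: "P 10 = 985" using rec[of 8] P8 P9 by simp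
  show "P 11 = 2378" using rec[of 9] P9 P10 by simp
qed

text \<open>Raising \<open>n\<close> by one moves the index by two, so the recurrence is applied
  twice. This is the induction step for the pair \<open>P (2 * n + 2)\<close>,
  \<open>P (2 * n + 3)\<close>.\<close>

lemma pell_sequence_two_step:
  assumes "is_pell_sequence P"
  shows "P (2 * Suc n + 2) = 2 * P (2 * n + 3) + P (2 * n + 2)"
    and "P (2 * Suc n + 3) = 2 * P (2 * Suc n + 2) + P (2 * n + 3)"
  using pell_sequence_rec[OF assms, of "2 * n + 2"] pell_sequence_rec[OF assms, of "2 * n + 3"]
  by (simp_all add: eval_nat_numeral)

text \<open>The bound 2 makes \<open>x = P (2 * n + 3) - 1\<close> positive; the bound on the
  even-indexed term carries the induction.\<close>

lemma pell_sequence_pos: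
  assumes "is_pell_sequence P"
  shows "P (2 * n + 2) \<ge> 1 \<and> P (2 * n + 3) \<ge> 2"
proof (induction n)
  case 0
  show ?case using pell_sequence_values(1)[OF assms] pell_sequence_initial[OF assms]
    by (simp flip: numeral_2_eq_2)
next
  case (Suc n)
  then show ?case using pell_sequence_two_step[OF assms, of n] by linarith
qed

text \<open>With \<open>a\<close> and \<open>b\<close> as above, a double step sends
  \<open>(a, b)\<close> to \<open>(3 * a + 2 * b, 4 * a + 3 * b)\<close>, that is, multiplies b + a
  sqrt 2 by 3 + 2 sqrt 2, which has norm 1. A single step multiplies by 1 + sqrt 2, of norm -1, and
  flips the sign of \<open>b\<^sup>2 - 2 * a\<^sup>2\<close>; hence only odd indices for
  \<open>a\<close>.\<close>

lemma pell_sequence_pell_equation: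
  assumes "is_pell_sequence P"
  shows "(P (2 * n + 3) + P (2 * n + 2))\<^sup>2 = 2 * (P (2 * n + 3))\<^sup>2 + 1"
proof (induction n)
  case 0
  show ?case using pell_sequence_values(1)[OF assms] pell_sequence_initial[OF assms]
    by (simp flip: numeral_2_eq_2)
next
  case (Suc n)
  then show ?case unfolding pell_sequence_two_step[OF assms, of n] by algebra
qed

lemma pell_sequence_quintic:
  assumes "is_pell_sequence P"
  defines "a \<equiv> \<lambda>n. of_int (P (2 * n + 3)) :: complex" and "c \<equiv> \<lambda>n. of_int (P (2 * n + 2)) :: complex"
  shows "(a n + 1) ^ 5 + (a n - 1) ^ 5 = (a n + \<i> * (a n + c n)) ^ 5 + (a n - \<i> * (a n + c n)) ^ 5"
proof (rule quintic_identity)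
  have "of_int ((P (2 * n + 3) + P (2 * n + 2))\<^sup>2) = (of_int (2 * (P (2 * n + 3))\<^sup>2 + 1) :: complex)"
    by (simp only: pell_sequence_pell_equation[OF assms(1)])
  then show "(a n + c n)\<^sup>2 = 2 * (a n)\<^sup>2 + 1"
    unfolding a_def c_def by simp
qed simp

lemma pell_quadruple_in_quintic_solutions:
  assumes "is_pell_sequence P"
  shows "pell_quadruple P n \<in> quintic_solutions"
proof -
  have gaussian: "of_int p + \<i> * of_int q \<in> gaussian_integers" for p q
    unfolding gaussian_integers_def by blast
  have gaussian_diff: "of_int p - \<i> * of_int q \<in> gaussian_integers" for p q
    using gaussian[of p "- q"] by simp
  show ?thesis
    using pell_sequence_pos[OF assms, of n] pell_sequence_quintic[OF assms, of n]
      gaussian[of "P (2 * n + 3)" "P (2 * n + 3) + P (2 * n + 2)"]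
      gaussian_diff[of "P (2 * n + 3)" "P (2 * n + 3) + P (2 * n + 2)"]
    by (simp add: pell_quadruple_def quintic_solutions_def)
qed

text \<open>This makes the family of solutions infinite: the terms \<open>P (2 * n + 3)\<close>
  strictly increase, and the first component determines them.\<close>

lemma inj_pell_quadruple:
  assumes "is_pell_sequence P"
  shows "inj (pell_quadruple P)"
proof -
  have "strict_mono (\<lambda>n. P (2 * n + 3))"
    unfolding strict_mono_Suc_iff
  proof
    show "P (2 * n + 3) < P (2 * Suc n + 3)" for n
      using pell_sequence_two_step[OF assms, of n] pell_sequence_pos[OF assms, of n] by linarith
  qed
  then have "inj (\<lambda>n. P (2 * n + 3))"
    by (rule strict_mono_imp_inj_on)
  then show ?thesis
    by (auto simp: inj_def pell_quadruple_def)
qed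

theorem theorem2p1:
  fixes P :: "nat \<Rightarrow> int"
  assumes "is_pell_sequence P"
  shows
    "map P [1..<12] = [0, 1, 2, 5, 12, 29, 70, 169, 408, 985, 2378] \<and>
     (\<forall>n::nat.
        (of_int (P (2 * n + 3)) + 1) ^ 5 + (of_int (P (2 * n + 3)) - 1) ^ 5 =
        (of_int (P (2 * n + 3)) + \<i> * (of_int (P (2 * n + 3)) + of_int (P (2 * n + 2)))) ^ 5 +
        (of_int (P (2 * n + 3)) - \<i> * (of_int (P (2 * n + 3)) + of_int (P (2 * n + 2)))) ^ 5) \<and>
     (\<forall>n. pell_quadruple P n \<in> quintic_solutions) \<and>
     inj (pell_quadruple P) \<and>
     pell_quadruple P 0 = (3, 1, 2 + 3 * \<i>, 2 - 3 * \<i>) \<and>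
     pell_quadruple P 1 = (13, 11, 12 + 17 * \<i>, 12 - 17 * \<i>) \<and>
     pell_quadruple P 2 = (71, 69, 70 + 99 * \<i>, 70 - 99 * \<i>) \<and>
     pell_quadruple P 3 = (409, 407, 408 + 577 * \<i>, 408 - 577 * \<i>) \<and>
     pell_quadruple P 4 = (2379, 2377, 2378 + 3363 * \<i>, 2378 - 3363 * \<i>) \<and>
     3 ^ 5 + 1 ^ 5 = (2 + 3 * \<i>) ^ 5 + (2 - 3 * \<i>) ^ 5 \<and>
     13 ^ 5 + 11 ^ 5 = (12 + 17 * \<i>) ^ 5 + (12 - 17 * \<i>) ^ 5 \<and>
     71 ^ 5 + 69 ^ 5 = (70 + 99 * \<i>) ^ 5 + (70 - 99 * \<i>) ^ 5 \<and>
     409 ^ 5 + 407 ^ 5 = (408 + 577 * \<i>) ^ 5 + (408 - 577 * \<i>) ^ 5 \<and>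
     2379 ^ 5 + 2377 ^ 5 = (2378 + 3363 * \<i>) ^ 5 + (2378 - 3363 * \<i>) ^ 5"
proof (intro conjI allI)
  show "map P [1..<12] = [0, 1, 2, 5, 12, 29, 70, 169, 408, 985, 2378]"
    using pell_sequence_values[OF assms] pell_sequence_initial[OF assms]
    by (simp add: upt_rec numeral_eq_Suc)
  show "pell_quadruple P n \<in> quintic_solutions" for n
    by (rule pell_quadruple_in_quintic_solutions[OF assms])
  show "inj (pell_quadruple P)"
    by (rule inj_pell_quadruple[OF assms])
  show "3 ^ 5 + 1 ^ 5 = (2 + 3 * \<i>) ^ 5 + (2 - 3 * \<i>) ^ 5"
    \<comment> \<open>The arguments are \<open>j\<close>, \<open>b\<close>, \<open>a\<close> in this
      order; the Pell equation here is 9 = 2 * 4 + 1.\<close>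
    using quintic_identity[of \<i> 3 2] by (simp add: mult.commute)
  show "13 ^ 5 + 11 ^ 5 = (12 + 17 * \<i>) ^ 5 + (12 - 17 * \<i>) ^ 5"
    using quintic_identity[of \<i> 17 12] by (simp add: mult.commute)
  show "71 ^ 5 + 69 ^ 5 = (70 + 99 * \<i>) ^ 5 + (70 - 99 * \<i>) ^ 5"
    using quintic_identity[of \<i> 99 70] by (simp add: mult.commute)
  show "409 ^ 5 + 407 ^ 5 = (408 + 577 * \<i>) ^ 5 + (408 - 577 * \<i>) ^ 5"
    using quintic_identity[of \<i> 577 408] by (simp add: mult.commute)
  show "2379 ^ 5 + 2377 ^ 5 = (2378 + 3363 * \<i>) ^ 5 + (2378 - 3363 * \<i>) ^ 5"
    using quintic_identity[of \<i> 3363 2378] by (simp add: mult.commute)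
\<comment> \<open>What remains is the identity for all \<open>n\<close> and the five quadruples,
  whose imaginary parts are 2 + 1, 12 + 5, 70 + 29, 408 + 169 and 2378 + 985 up to sign.\<close>
qed (rule pell_sequence_quintic[OF assms], use pell_sequence_values[OF assms] pell_sequence_initial[OF assms] in
    \<open>simp_all add: pell_quadruple_def mult.commute flip: numeral_2_eq_2\<close>)

end
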